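(* Let $(S,d)$ and $(T,\rho)$ be bounded metric spaces, let $F\colon S\to T$ be a bijection, and let $\{\mathbf X^n\}_{n\in\mathbb N_0}$ be a quasi-visual approximation of $(S,d)$. Then $F\colon S\to T$ is a quasisymmetry if and only if $\{F(\mathbf X^n)\}_{n\in\mathbb N_0}$ is a quasi-visual approximation of $(T,\rho)$, where $F(\mathbf X^n)=\{F(X):X\in\mathbf X^n\}$.
   Context: $\mathbb N_0=\{0,1,2,\dots\}$. For non-negative quantities, $a\asymp b$ means $a/C\le b\le Ca$ and $a\gtrsim b$ means $b\le Ca$, with a constant $C>0$. $\operatorname{dist}(X,Y)=\inf\{d(x,y):x\in X,y\in Y\}$. Quasisymmetry: a homeomorphism $F\colon (S,d)\to(T,\rho)$ is a quasisymmetry if there exists a homeomorphism $\eta\colon[0,\infty)\to[0,\infty)$ such that for all $t>0$ and all $x,y,z\in S$, $d(x,y)\le t\,d(x,z)$ implies $\rho(F(x),F(y))\le \eta(t)\,\rho(F(x),F(z))$. Quasi-visual approximation: for a bounded metric space $S$, it is a sequence $\{\mathbf X^n\}_{n\in\mathbb N_0}$ of finite covers $\mathbf X^n$ of $S$ by some of its subsets, with $\mathbf X^0=\{S\}$, such that for all $n\in\mathbb N_0$, with implicit constants independent of $n,X,Y$: (i) $\operatorname{diam}(X)\asymp\operatorname{diam}(Y)$ for all $X,Y\in\mathbf X^n$ with $X\cap Y\ne\emptyset$; (ii) $\operatorname{dist}(X,Y)\gtrsim\operatorname{diam}(X)$ for all $X,Y\in\mathbf X^n$ with $X\cap Y=\emptyset$;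 (iii) $\operatorname{diam}(X)\asymp\operatorname{diam}(Y)$ for all $X\in\mathbf X^n$, $Y\in\mathbf X^{n+1}$ with $X\cap Y\ne\emptyset$; (iv) for some constants $k_0\in\mathbb N_0$ and $\lambda\in(0,1)$ independent of $n$, $\operatorname{diam}(Y)\le\lambda\operatorname{diam}(X)$ for all $X\in\mathbf X^n$, $Y\in\mathbf X^{n+k_0}$ with $X\cap Y\ne\emptyset$. *)

theory Defs
  imports "HOL-Analysis.Analysis"
begin

text \<open>Metric spaces are rendered as subsets of types of class \<open>metric_space\<close>, with the restricted
  metric; the empty space is included.\<close>

definition quasisymmetry ::
    "'a::metric_space set \<Rightarrow> 'b::metric_space set \<Rightarrow> ('a \<Rightarrow> 'b) \<Rightarrow> bool" where
  "quasisymmetry S T F \<longleftrightarrow>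
     (\<exists>G. homeomorphism S T F G) \<and>
     (\<exists>\<eta> \<theta>. homeomorphism {0::real..} {0::real..} \<eta> \<theta> \<and>
        (\<forall>t>0. \<forall>x\<in>S. \<forall>y\<in>S. \<forall>z\<in>S.
           dist x y \<le> t * dist x z \<longrightarrow> dist (F x) (F y) \<le> \<eta> t * dist (F x) (F z)))"

definition comparable :: "real \<Rightarrow> real \<Rightarrow> real \<Rightarrow> bool" where
  "comparable C a b \<longleftrightarrow> a / C \<le> b \<and> b \<le> C * a"

text \<open>In the separation condition \<open>diameter X \<le> C * setdist X Y\<close> the sets are required to be nonempty because
  \<^const>\<open>setdist\<close> is \<open>0\<close> if one of its arguments is empty, whereas the infimum of the empty set of
  distances is \<open>\<infinity>\<close>, so that an empty set imposes no condition there.\<close>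

definition quasi_visual_approximation ::
    "'a::metric_space set \<Rightarrow> (nat \<Rightarrow> 'a set set) \<Rightarrow> bool" where
  "quasi_visual_approximation S \<X> \<longleftrightarrow>
     bounded S \<and>
     (\<forall>n. finite (\<X> n) \<and> \<Union>(\<X> n) = S) \<and>
     \<X> 0 = {S} \<and>
     (\<exists>C>0. \<forall>n. \<forall>X\<in>\<X> n. \<forall>Y\<in>\<X> n.
        X \<inter> Y \<noteq> {} \<longrightarrow> comparable C (diameter X) (diameter Y)) \<and>
     (\<exists>C>0. \<forall>n. \<forall>X\<in>\<X> n. \<forall>Y\<in>\<X> n.
        X \<noteq> {} \<and> Y \<noteq> {} \<and> X \<inter> Y = {} \<longrightarrow> diameter X \<le> C * setdist X Y) \<and>
     (\<exists>C>0. \<forall>n. \<forall>X\<in>\<X> n. \<forall>Y\<in>\<X> (Suc n).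
        X \<inter> Y \<noteq> {} \<longrightarrow> comparable C (diameter X) (diameter Y)) \<and>
     (\<exists>k\<^sub>0::nat. \<exists>l::real. 0 < l \<and> l < 1 \<and>
        (\<forall>n. \<forall>X\<in>\<X> n. \<forall>Y\<in>\<X> (n + k\<^sub>0).
           X \<inter> Y \<noteq> {} \<longrightarrow> diameter Y \<le> l * diameter X))"

end

theory Submission
  imports Defs
begin

text \<open>
  A quasi-visual approximation encodes a metric, up to multiplicative constants, in two pieces of
  data: which sets of the covers meet, and the diameters of these sets. The bijection \<open>F\<close> keeps the
  first piece; so only diameters have to be compared.

  If \<open>F\<close> is a quasisymmetry and two sets \<open>X\<close> and \<open>Y\<close> meet, then \<open>diameter X \<le> t * diameter Y\<close>
  implies \<open>diameter (F ` X) \<le> 2 * \<eta> (3 * t) * diameter (F ` Y)\<close>, because the distances from a common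
  point recover the diameters up to factors \<open>2\<close> and \<open>3\<close>
  (\<open>quasisymmetric_diameter_image\<close>). This transports the comparability conditions. It also transports
  the contraction condition: over \<open>k\<close> levels the diameters shrink by a factor tending to \<open>0\<close> as \<open>k\<close>
  grows, and \<open>\<eta>\<close> is continuous with \<open>\<eta> 0 = 0\<close>. The separation condition is a direct use of the
  quasisymmetric inequality.

  For the converse, consider distinct points \<open>x\<close> and \<open>y\<close> and the first level at which they lie in
  disjoint sets of the cover. One level above it, any set \<open>X\<close> that contains \<open>x\<close> satisfies
  \<open>dist x y \<asymp> diameter X\<close> (\<open>splitting_level_dist\<close>). Since this level is defined by
  incidences alone, it is the same for \<open>F x\<close> and \<open>F y\<close>, and \<open>dist (F x) (F y) \<asymp> diameter (F ` X)\<close>.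
  Comparing \<open>dist x y\<close> with \<open>dist x z\<close> thus becomes comparing the diameters of two sets through \<open>x\<close>
  at levels \<open>n\<close> and \<open>m\<close>. In both spaces the ratio of these diameters is controlled from both sides by
  geometric factors in \<open>n - m\<close> (\<open>quasi_visual_approximation_scale_control\<close>): the ratio in \<open>S\<close> bounds
  \<open>n - m\<close>, and \<open>n - m\<close> bounds the ratio in \<open>T\<close>. The outcome is a gauge of power type,
  \<open>\<eta> t = M * ((c * t) powr a + (c * t) powr (1 / a))\<close>. The same argument for the inverse map shows
  that both maps are continuous.
\<close>

section \<open>Diameters and homeomorphisms of the half-line\<close>

lemma diameter_le_dist:
  fixes A :: "'a::metric_space set"
  assumes "\<And>x y. x \<in> A \<Longrightarrow> y \<in> A \<Longrightarrow> dist x y \<le> r" "0 \<le> r"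
  shows "diameter A \<le> r"
  using assms by (auto simp: diameter_def intro!: cSUP_least)

lemma diameter_le_twice_radius:
  fixes A :: "'a::metric_space set"
  assumes "\<And>y. y \<in> A \<Longrightarrow> dist x y \<le> r" "0 \<le> r"
  shows "diameter A \<le> 2 * r"
proof (rule diameter_le_dist)
  show "dist y z \<le> 2 * r" if "y \<in> A" "z \<in> A" for y z
    using assms(1)[OF that(1)] assms(1)[OF that(2)] dist_triangle3[of y z x] by linarith
qed (use assms in simp)

lemma diameter_almost_radius:
  fixes A :: "'a::metric_space set"
  assumes "bounded A" "x \<in> A"
  obtains z where "z \<in> A" "diameter A \<le> 3 * dist x z"
proof -
  have "\<exists>z\<in>A. diameter A \<le> 3 * dist x z"
  proof (rule ccontr)
    assume "\<not> ?thesis"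
    hence far: "3 * dist x z < diameter A" if "z \<in> A" for z
      using that by force
    have pos: "0 < diameter A"
      using far[OF assms(2)] by simp
    have "diameter A \<le> 2 * (diameter A / 3)"
      using far pos by (intro diameter_le_twice_radius[of _ x]) (auto simp: less_imp_le field_simps)
    with pos show False by simp
  qed
  with that show ?thesis by blast
qed

text \<open>Removing an interior point disconnects the half-line, and removing its endpoint does not.\<close>

lemma homeomorphism_half_line_0:
  fixes f g :: "real \<Rightarrow> real"
  assumes "homeomorphism {0..} {0..} f g"
  shows "f 0 = 0"
proof (rule ccontr)
  assume nz: "f 0 \<noteq> 0"
  have inj: "inj_on f {0..}" and im: "f ` {0..} = {0..}" and cont: "continuous_on {0..} f"
    using assms by (auto simp: homeomorphism_def inj_on_def) (metis atLeast_iff)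
  have "f ` {0<..} = f ` ({0..} - {0})"
    by (rule arg_cong[where f = "image f"]) auto
  also have "\<dots> = {0..} - {f 0}"
    using inj im by (auto simp: inj_on_image_set_diff[where C = "{0..}"])
  finally have eq: "f ` {0<..} = {0..} - {f 0}" .
  have "connected (f ` {0<..})"
    by (intro connected_continuous_image continuous_on_subset[OF cont] connected_Ioi) auto
  hence "connected ({0..} - {f 0})" by (simp add: eq)
  moreover have "0 < f 0"
    using nz im by (metis atLeast_iff image_eqI order_le_less order_refl)
  ultimately have "f 0 \<in> {0..} - {f 0}"
    using connectedD_interval[of "{0..} - {f 0}" 0 "f 0 + 1" "f 0"] by force
  thus False by simp
qed

lemma homeomorphism_half_line_small:
  fixes f g :: "real \<Rightarrow> real"
  assumes "homeomorphism {0..} {0..} f g" "0 < e"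
  obtains d where "0 < d" "\<And>t. 0 \<le> t \<Longrightarrow> t < d \<Longrightarrow> f t < e"
proof -
  have cont: "continuous_on {0..} f"
    using assms by (auto simp: homeomorphism_def)
  obtain d where "0 < d" "\<forall>t\<in>{0..}. dist t 0 < d \<longrightarrow> dist (f t) (f 0) < e"
    using cont assms(2) unfolding continuous_on_iff by (meson atLeast_iff order_refl)
  thus ?thesis
    using that[of d] homeomorphism_half_line_0[OF assms(1)] by (force simp: dist_real_def)
qed

lemma homeomorphism_power_gauge:
  fixes a b c m :: real
  assumes "0 < a" "0 < b" "0 < c" "0 < m"
  shows "\<exists>g. homeomorphism {0..} {0..} (\<lambda>t. m * ((c * t) powr a + (c * t) powr b)) g"
proof -
  let ?f = "\<lambda>t::real. m * ((c * t) powr a + (c * t) powr b)"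
  have cont: "continuous_on {0..} ?f"
    using assms by (intro continuous_intros continuous_on_powr') auto
  have mono: "?f s < ?f t" if "0 \<le> s" "s < t" for s t
    using assms that by (intro mult_strict_left_mono add_strict_mono powr_less_mono2) auto
  have inj: "inj_on ?f {0..}"
  proof (rule inj_onI)
    fix s t assume "s \<in> {0..}" "t \<in> {0..}" "?f s = ?f t"
    thus "s = t"
      using mono[of s t] mono[of t s] by (cases s t rule: linorder_cases) auto
  qed
  have surj: "u \<in> ?f ` {0..}" if u: "0 \<le> u" for u
  proof -
    define t where "t = (u / m) powr (1 / a) / c"
    have t: "0 \<le> t" using assms by (simp add: t_def)
    have "u = m * (c * t) powr a"
      using assms u by (simp add: t_def powr_powr)
    also have "\<dots> \<le> ?f t" using assms by simp
    finally have "u \<le> ?f t" .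
    moreover have "?f 0 \<le> u" using u assms by simp
    ultimately obtain s where "0 \<le> s" "?f s = u"
      using IVT'[of ?f 0 u t] t continuous_on_subset[OF cont, of "{0..t}"] by auto
    thus ?thesis by (intro rev_image_eqI[of s]) simp_all
  qed
  have "0 \<le> ?f t" for t
    using assms by simp
  hence "?f ` {0..} = {0..}"
    using surj by (intro subset_antisym image_subsetI subsetI) simp_all
  moreover have "path_connected {0::real..}"
    by (intro convex_imp_path_connected) simp
  ultimately show ?thesis
    using cont inj by (intro homeomorphism_into_1d)
qed

section \<open>Geometric control of diameters along a quasi-visual approximation\<close>

text \<open>
  The case \<open>k = 0\<close> of the two-sided estimate is the comparability of intersecting sets of one level.
  All constants may be enlarged, with \<open>l\<close> kept below \<open>1\<close> (\<open>scale_control_mono\<close>), so that a space and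
  its image can share them; with shared rates \<open>l\<close> and \<open>L\<close>, a single exponent relates the two spaces.
\<close>

definition scale_control ::
    "'a::metric_space set \<Rightarrow> (nat \<Rightarrow> 'a set set) \<Rightarrow> real \<Rightarrow> real \<Rightarrow> real \<Rightarrow> bool" where
  "scale_control S \<X> A l L \<longleftrightarrow>
     bounded S \<and> (\<forall>n. \<Union>(\<X> n) = S) \<and> \<X> 0 = {S} \<and> 1 \<le> A \<and> 0 < l \<and> l < 1 \<and> 1 < L \<and>
     (\<forall>n k. \<forall>X\<in>\<X> n. \<forall>Y\<in>\<X> (n + k). X \<inter> Y \<noteq> {} \<longrightarrow>
        diameter Y \<le> A * l ^ k * diameter X \<and> diameter X \<le> A * L ^ k * diameter Y) \<and>
     (\<forall>n. \<forall>X\<in>\<X> n. \<forall>Y\<in>\<X> n.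
        X \<noteq> {} \<and> Y \<noteq> {} \<and> X \<inter> Y = {} \<longrightarrow> diameter X \<le> A * setdist X Y)"

lemma scale_control_shrink:
  assumes "scale_control S \<X> A l L" "X \<in> \<X> n" "Y \<in> \<X> (n + k)" "X \<inter> Y \<noteq> {}"
  shows "diameter Y \<le> A * l ^ k * diameter X"
  using assms unfolding scale_control_def by blast

lemma scale_control_grow:
  assumes "scale_control S \<X> A l L" "X \<in> \<X> n" "Y \<in> \<X> (n + k)" "X \<inter> Y \<noteq> {}"
  shows "diameter X \<le> A * L ^ k * diameter Y"
  using assms unfolding scale_control_def by blast

lemma scale_control_separated:
  assumes "scale_control S \<X> A l L" "X \<in> \<X> n" "Y \<in> \<X> n" "X \<inter> Y = {}" "x \<in> X" "y \<in> Y"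
  shows "diameter X \<le> A * dist x y"
proof -
  have "diameter X \<le> A * setdist X Y" "1 \<le> A"
    using assms unfolding scale_control_def by blast+
  moreover have "A * setdist X Y \<le> A * dist x y"
    using assms \<open>1 \<le> A\<close> by (intro mult_left_mono setdist_le_dist) auto
  ultimately show ?thesis by linarith
qed

lemma scale_control_member:
  assumes "scale_control S \<X> A l L" "X \<in> \<X> n"
  shows "X \<subseteq> S" "bounded X" "0 \<le> diameter X"
proof -
  have "\<Union>(\<X> n) = S" and S: "bounded S"
    using assms(1) by (auto simp: scale_control_def)
  with assms(2) show "X \<subseteq> S" by blast
  with S show "bounded X" by (rule bounded_subset)
  thus "0 \<le> diameter X" by (rule diameter_ge_0)
qed

lemma scale_control_cover:
  assumes "scale_control S \<X> A l L" "x \<in> S"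
  obtains X where "X \<in> \<X> n" "x \<in> X"
proof -
  have "\<Union>(\<X> n) = S" using assms(1) by (simp add: scale_control_def)
  with assms(2) that show ?thesis by blast
qed

lemma scale_control_mono:
  assumes "scale_control S \<X> A l L" "A \<le> A'" "l \<le> l'" "l' < 1" "L \<le> L'"
  shows "scale_control S \<X> A' l' L'"
proof -
  note sc = scale_control_member[OF assms(1)]
  have A: "1 \<le> A" "0 < l" "1 < L"
    using assms(1) by (auto simp: scale_control_def)
  have "diameter Y \<le> A' * l' ^ k * diameter X \<and> diameter X \<le> A' * L' ^ k * diameter Y"
    if "X \<in> \<X> n" "Y \<in> \<X> (n + k)" "X \<inter> Y \<noteq> {}" for n k X Y
  proof -
    have "A * l ^ k * diameter X \<le> A' * l' ^ k * diameter X"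
      "A * L ^ k * diameter Y \<le> A' * L' ^ k * diameter Y"
      using sc(3)[OF that(1)] sc(3)[OF that(2)] A assms
      by (intro mult_right_mono mult_mono power_mono; simp)+
    with scale_control_shrink[OF assms(1) that] scale_control_grow[OF assms(1) that]
    show ?thesis by linarith
  qed
  moreover have "diameter X \<le> A' * setdist X Y"
    if "X \<in> \<X> n" "Y \<in> \<X> n" "X \<noteq> {}" "Y \<noteq> {}" "X \<inter> Y = {}" for n X Y
  proof -
    have "diameter X \<le> A * setdist X Y"
      using that assms(1) unfolding scale_control_def by blast
    also have "\<dots> \<le> A' * setdist X Y"
      using assms by (intro mult_right_mono) (auto simp: setdist_pos_le)
    finally show ?thesis .
  qed
  ultimately show ?thesis
    using assms A unfolding scale_control_def by auto
qed

lemma comparable_swap: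
  assumes "comparable C a b" "0 < C" "C \<le> K" "0 \<le> a" "0 \<le> b"
  shows "b \<le> K * a" "a \<le> K * b"
proof -
  have "b \<le> C * a" "a \<le> C * b"
    using assms by (auto simp: comparable_def field_simps)
  moreover have "C * a \<le> K * a" "C * b \<le> K * b"
    using assms by (auto intro: mult_right_mono)
  ultimately show "b \<le> K * a" "a \<le> K * b" by linarith+
qed

text \<open>
  To compare levels \<open>n\<close> and \<open>n + k\<close>, a point of \<open>X \<inter> Y\<close> is followed through the intermediate covers.
  Single steps lose at most a factor \<open>K\<close> in either direction, and blocks of \<open>q\<close> steps gain a factor
  \<open>l0\<close>; the rate per step is hence \<open>root q l0\<close>, and the remainder of fewer than \<open>q\<close> steps is
  absorbed into the constant.
\<close>

lemma quasi_visual_approximation_scale_control: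
  assumes "quasi_visual_approximation S \<X>"
  obtains A l L where "scale_control S \<X> A l L"
proof -
  have bS: "bounded S" and un: "\<And>n. \<Union>(\<X> n) = S" and X0: "\<X> 0 = {S}"
    using assms by (auto simp: quasi_visual_approximation_def)
  have nn: "0 \<le> diameter X" if "X \<in> \<X> n" for X n
    using that un bS by (metis Sup_upper bounded_subset diameter_ge_0)
  obtain C1 where C1: "0 < C1" "\<forall>n. \<forall>X\<in>\<X> n. \<forall>Y\<in>\<X> n.
      X \<inter> Y \<noteq> {} \<longrightarrow> comparable C1 (diameter X) (diameter Y)"
    using assms unfolding quasi_visual_approximation_def by (elim conjE exE) (rule that)
  obtain C2 where C2: "0 < C2" "\<forall>n. \<forall>X\<in>\<X> n. \<forall>Y\<in>\<X> n.
      X \<noteq> {} \<and> Y \<noteq> {} \<and> X \<inter> Y = {} \<longrightarrow> diameter X \<le> C2 * setdist X Y"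
    using assms unfolding quasi_visual_approximation_def by (elim conjE exE) (rule that)
  obtain C3 where C3: "0 < C3" "\<forall>n. \<forall>X\<in>\<X> n. \<forall>Y\<in>\<X> (Suc n).
      X \<inter> Y \<noteq> {} \<longrightarrow> comparable C3 (diameter X) (diameter Y)"
    using assms unfolding quasi_visual_approximation_def by (elim conjE exE) (rule that)
  obtain k0 l0 where l0: "0 < l0" "l0 < 1" "\<forall>n. \<forall>X\<in>\<X> n. \<forall>Y\<in>\<X> (n + k0).
      X \<inter> Y \<noteq> {} \<longrightarrow> diameter Y \<le> l0 * diameter X"
    using assms unfolding quasi_visual_approximation_def by (elim conjE exE) (rule that)
  define K where "K = 1 + C1 + C3"
  have K: "1 < K" "C1 \<le> K" "C3 \<le> K" using C1(1) C3(1) by (auto simp: K_def)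
  have same: "diameter Y \<le> K * diameter X" if "X \<in> \<X> n" "Y \<in> \<X> n" "X \<inter> Y \<noteq> {}" for n X Y
    using comparable_swap(1)[OF C1(2)[rule_format, OF that] C1(1) K(2)] nn that by blast
  have next_le: "diameter Y \<le> K * diameter X" "diameter X \<le> K * diameter Y"
    if "X \<in> \<X> n" "Y \<in> \<X> (Suc n)" "X \<inter> Y \<noteq> {}" for n X Y
    using comparable_swap[OF C3(2)[rule_format, OF that] C3(1) K(3)] nn that by blast+
  have crude: "diameter Y \<le> K * K ^ k * diameter X \<and> diameter X \<le> K * K ^ k * diameter Y"
    if "X \<in> \<X> n" "Y \<in> \<X> (n + k)" "X \<inter> Y \<noteq> {}" for n k X Y
    using that
  proof (induction k arbitrary: Y)
    case 0
    thus ?case using same[of X n Y] same[of Y n X] by (auto simp: Int_commute)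
  next
    case (Suc k)
    obtain p where p: "p \<in> X" "p \<in> Y" using Suc.prems by auto
    have "p \<in> S" using p Suc.prems un by blast
    then obtain W where W: "W \<in> \<X> (n + k)" "p \<in> W" using un by blast
    have 1: "diameter W \<le> K * K ^ k * diameter X" "diameter X \<le> K * K ^ k * diameter W"
      using Suc.IH[OF Suc.prems(1) W(1)] p W by auto
    have 2: "diameter Y \<le> K * diameter W" "diameter W \<le> K * diameter Y"
      using next_le[OF W(1), of Y] Suc.prems p W by auto
    have "K * diameter W \<le> K * (K * K ^ k * diameter X)"
      using 1 K by (intro mult_left_mono) auto
    moreover have "K * K ^ k * diameter W \<le> K * K ^ k * (K * diameter Y)"
      using 2 K by (intro mult_left_mono) auto
    ultimately show ?case using 1 2 by (simp add: mult_ac)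
  qed
  \<comment> \<open>For \<open>k0 = 0\<close> the contraction condition forces all diameters to vanish, so one
     may use step size \<open>1\<close> instead.\<close>
  obtain q where q: "0 < q" "\<And>n X Y. X \<in> \<X> n \<Longrightarrow> Y \<in> \<X> (n + q) \<Longrightarrow> X \<inter> Y \<noteq> {} \<Longrightarrow>
             diameter Y \<le> l0 * diameter X"
  proof (cases "k0 = 0")
    case True
    have "diameter Y \<le> l0 * diameter X"
      if "X \<in> \<X> n" "Y \<in> \<X> (n + 1)" "X \<inter> Y \<noteq> {}" for n X Y
    proof -
      have "diameter X \<le> l0 * diameter X"
        using l0(3) that True by fastforce
      hence "(1 - l0) * diameter X \<le> 0" by (simp add: algebra_simps)
      hence "diameter X = 0"
        using nn[OF that(1)] l0 by (simp add: mult_le_0_iff)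
      thus ?thesis using next_le(1)[of X n Y] that by simp
    qed
    with that[of 1] show ?thesis by auto
  next
    case False
    with that[of k0] l0 show ?thesis by auto
  qed
  define m where "m = root q l0"
  have mq: "m ^ q = l0" using q l0 by (simp add: m_def real_root_pow_pos)
  have m: "0 < m" "m < 1" using q l0 by (auto simp: m_def)
  define A0 where "A0 = K * (K / m) ^ q"
  have A0: "0 \<le> A0" using K m by (simp add: A0_def)
  have shrink: "diameter Y \<le> A0 * m ^ k * diameter X"
    if "X \<in> \<X> n" "Y \<in> \<X> (n + k)" "X \<inter> Y \<noteq> {}" for n k X Y
    using that
  proof (induction k arbitrary: Y rule: less_induct)
    case (less k)
    show ?case
    proof (cases "k < q")
      case True
      have "K ^ k \<le> K ^ q" using True K by (intro power_increasing) auto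
      moreover have "m ^ q \<le> m ^ k" using True m by (intro power_decreasing) auto
      ultimately have "K ^ k * m ^ q \<le> K ^ q * m ^ k" using K m by (intro mult_mono) auto
      hence "K * K ^ k \<le> A0 * m ^ k"
        using K m by (simp add: A0_def power_divide field_simps)
      hence "K * K ^ k * diameter X \<le> A0 * m ^ k * diameter X"
        using nn[OF less.prems(1)] by (rule mult_right_mono)
      thus ?thesis using crude[OF less.prems] by linarith
    next
      case False
      define j where "j = k - q"
      have k: "k = j + q" "j < k" using False q by (auto simp: j_def)
      obtain p where p: "p \<in> X" "p \<in> Y" using less.prems by auto
      have "p \<in> S" using p less.prems un by blast
      then obtain W where W: "W \<in> \<X> (n + j)" "p \<in> W" using un by blast
      have "diameter W \<le> A0 * m ^ j * diameter X"
        using less.IH[OF k(2) less.prems(1) W(1)] p W by auto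
      hence "l0 * diameter W \<le> l0 * (A0 * m ^ j * diameter X)"
        using l0 by (intro mult_left_mono) auto
      moreover have "diameter Y \<le> l0 * diameter W"
        using q(2)[OF W(1), of Y] less.prems p W k by (auto simp: add.assoc)
      ultimately show ?thesis using mq by (simp add: k(1) power_add mult_ac)
    qed
  qed
  define A where "A = K + C2 + A0"
  have A: "1 \<le> A" "K \<le> A" "C2 \<le> A" "A0 \<le> A"
    using K C2(1) A0 by (auto simp: A_def)
  have "diameter Y \<le> A * m ^ k * diameter X \<and> diameter X \<le> A * K ^ k * diameter Y"
    if "X \<in> \<X> n" "Y \<in> \<X> (n + k)" "X \<inter> Y \<noteq> {}" for n k X Y
  proof -
    have "A0 * m ^ k * diameter X \<le> A * m ^ k * diameter X"
      "K * K ^ k * diameter Y \<le> A * K ^ k * diameter Y"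
      using nn[OF that(1)] nn[OF that(2)] A m K by (intro mult_right_mono; simp)+
    thus ?thesis using shrink[OF that] crude[OF that] by linarith
  qed
  moreover have "diameter X \<le> A * setdist X Y"
    if "X \<in> \<X> n" "Y \<in> \<X> n" "X \<noteq> {}" "Y \<noteq> {}" "X \<inter> Y = {}" for n X Y
  proof -
    have "C2 * setdist X Y \<le> A * setdist X Y"
      using A by (intro mult_right_mono) (auto simp: setdist_pos_le)
    moreover have "diameter X \<le> C2 * setdist X Y"
      using C2(2) that by blast
    ultimately show ?thesis by linarith
  qed
  ultimately have "scale_control S \<X> A m K"
    unfolding scale_control_def using bS un X0 A m K by auto
  thus ?thesis by (rule that)
qed

section \<open>Quasisymmetries preserve quasi-visual approximations\<close>

text \<open>
  For a common point \<open>x\<close> of \<open>X\<close> and \<open>Y\<close>, some \<open>z \<in> Y\<close> realises the diameter of \<open>Y\<close> up to a factor \<open>3\<close>,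
  so \<open>dist x y \<le> 3 * t * dist x z\<close> for every \<open>y \<in> X\<close>; the factor \<open>2\<close> passes from the radius about
  \<open>F x\<close> to the diameter.
\<close>

lemma quasisymmetric_diameter_image:
  fixes F :: "'a::metric_space \<Rightarrow> 'b::metric_space"
  assumes qs: "\<And>t x y z. 0 < t \<Longrightarrow> x \<in> S \<Longrightarrow> y \<in> S \<Longrightarrow> z \<in> S \<Longrightarrow> dist x y \<le> t * dist x z \<Longrightarrow>
                 dist (F x) (F y) \<le> \<eta> t * dist (F x) (F z)"
    and eta: "\<And>t. 0 \<le> t \<Longrightarrow> 0 \<le> \<eta> t"
    and S: "bounded S" "bounded (F ` S)"
    and XY: "X \<subseteq> S" "Y \<subseteq> S" "X \<inter> Y \<noteq> {}"
    and t: "0 < t" "diameter X \<le> t * diameter Y"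
  shows "diameter (F ` X) \<le> 2 * \<eta> (3 * t) * diameter (F ` Y)"
proof -
  have b: "bounded X" "bounded Y" "bounded (F ` Y)"
    using S XY by (meson bounded_subset image_mono)+
  obtain x where x: "x \<in> X" "x \<in> Y" using XY by auto
  obtain z where z: "z \<in> Y" "diameter Y \<le> 3 * dist x z"
    using diameter_almost_radius[OF b(2) x(2)] by blast
  have "diameter (F ` X) \<le> 2 * (\<eta> (3 * t) * diameter (F ` Y))"
  proof (rule diameter_le_twice_radius[of _ "F x"])
    fix v assume "v \<in> F ` X"
    then obtain y where y: "y \<in> X" "v = F y" by auto
    have "dist x y \<le> diameter X"
      using b x y by (intro diameter_bounded_bound)
    also have "\<dots> \<le> t * (3 * dist x z)"
      using t z by (meson mult_left_mono order_trans less_imp_le)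
    finally have "dist (F x) (F y) \<le> \<eta> (3 * t) * dist (F x) (F z)"
      using x y z XY t by (intro qs) (auto simp: mult_ac)
    also have "\<dots> \<le> \<eta> (3 * t) * diameter (F ` Y)"
      using b x z t by (intro mult_left_mono diameter_bounded_bound eta) auto
    finally show "dist (F x) v \<le> \<eta> (3 * t) * diameter (F ` Y)" by (simp add: y)
  qed (use t b in \<open>auto intro!: mult_nonneg_nonneg eta diameter_ge_0\<close>)
  thus ?thesis by (simp add: mult_ac)
qed

lemma comparable_of_le:
  assumes "b \<le> K * a" "a \<le> K * b" "K \<le> C" "0 < C" "0 \<le> a" "0 \<le> b"
  shows "comparable C a b"
proof -
  have "K * a \<le> C * a" "K * b \<le> C * b"
    using assms by (auto intro: mult_right_mono)
  hence "b \<le> C * a" "a \<le> C * b" using assms by linarith+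
  thus ?thesis using assms by (simp add: comparable_def field_simps)
qed

lemma quasisymmetry_imp_quasi_visual_image:
  fixes F :: "'a::metric_space \<Rightarrow> 'b::metric_space"
  assumes bT: "bounded T" and bij: "bij_betw F S T"
    and qv: "quasi_visual_approximation S \<X>" and F: "quasisymmetry S T F"
  shows "quasi_visual_approximation T (\<lambda>n. (\<lambda>X. F ` X) ` \<X> n)"
proof -
  obtain A l L where sc: "scale_control S \<X> A l L"
    using quasi_visual_approximation_scale_control[OF qv] .
  have A: "1 \<le> A" "0 < l" "l < 1" "1 < L" and bS: "bounded S"
    and un: "\<And>n. \<Union>(\<X> n) = S" and X0: "\<X> 0 = {S}"
    using sc by (auto simp: scale_control_def)
  have fin: "\<And>n. finite (\<X> n)"
    using qv by (auto simp: quasi_visual_approximation_def)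
  obtain \<eta> \<theta> where hom: "homeomorphism {0..} {0..} \<eta> \<theta>"
    and qs: "\<And>t x y z. 0 < t \<Longrightarrow> x \<in> S \<Longrightarrow> y \<in> S \<Longrightarrow> z \<in> S \<Longrightarrow> dist x y \<le> t * dist x z \<Longrightarrow>
                 dist (F x) (F y) \<le> \<eta> t * dist (F x) (F z)"
    using F unfolding quasisymmetry_def by metis
  have eta: "0 \<le> \<eta> t" if "0 \<le> t" for t
    using hom that unfolding homeomorphism_def by (metis atLeast_iff imageI)
  have FS: "F ` S = T" and inj: "inj_on F S"
    using bij by (auto simp: bij_betw_def)
  note sub = scale_control_member(1)[OF sc]
  have meet: "X \<inter> Y \<noteq> {}" if "X \<in> \<X> n" "Y \<in> \<X> m" "F ` X \<inter> F ` Y \<noteq> {}" for n m X Y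
    using that inj_on_image_Int[OF inj sub[OF that(1)] sub[OF that(2)]] by auto
  have nn: "0 \<le> diameter (F ` X)" if "X \<in> \<X> n" for n X
    using sub[OF that] FS bT by (metis bounded_subset diameter_ge_0 image_mono)
  note image = quasisymmetric_diameter_image[where \<eta> = \<eta>, OF qs eta bS]
  have image: "diameter (F ` X) \<le> 2 * \<eta> (3 * t) * diameter (F ` Y)"
    if "X \<in> \<X> n" "Y \<in> \<X> m" "X \<inter> Y \<noteq> {}" "0 < t" "diameter X \<le> t * diameter Y" for n m X Y t
    using image[OF _ _ _ _ _ _ _ sub[OF that(1)] sub[OF that(2)]] that FS bT by simp
  \<comment> \<open>One comparison constant serves levels \<open>n, n\<close> and \<open>n, n + 1\<close>.\<close>
  have AL: "0 < A * L" "A * 1 \<le> A * L" "A * l \<le> A * L"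
    using A by (auto intro: mult_left_mono)
  define K where "K = 2 * \<eta> (3 * (A * L))"
  have near: "comparable (1 + K) (diameter (F ` X)) (diameter (F ` Y))"
    if k: "k \<le> 1" and X: "X \<in> \<X> n" and Y: "Y \<in> \<X> (n + k)" and m: "X \<inter> Y \<noteq> {}" for n k X Y
  proof (rule comparable_of_le[where K = K])
    have c: "A * l ^ k \<le> A * L" "A * L ^ k \<le> A * L"
      using k AL by (cases k; simp)+
    have "A * l ^ k * diameter X \<le> A * L * diameter X"
      "A * L ^ k * diameter Y \<le> A * L * diameter Y"
      using c scale_control_member(3)[OF sc] X Y by (blast intro: mult_right_mono)+
    hence "diameter Y \<le> A * L * diameter X" "diameter X \<le> A * L * diameter Y"
      using scale_control_shrink[OF sc X Y m] scale_control_grow[OF sc X Y m] by linarith+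
    thus "diameter (F ` Y) \<le> K * diameter (F ` X)" "diameter (F ` X) \<le> K * diameter (F ` Y)"
      unfolding K_def using image[OF X Y m AL(1)] image[OF Y X _ AL(1)] m by (auto simp: Int_commute)
    have "0 \<le> K" using AL by (auto simp: K_def intro!: eta)
    thus "0 < 1 + K" by simp
  qed (use nn X Y in auto)
  have near': "comparable (1 + K) (diameter U) (diameter V)"
    if "k \<le> 1" "U \<in> (`) F ` \<X> n" "V \<in> (`) F ` \<X> (n + k)" "U \<inter> V \<noteq> {}" for n k U V
  proof -
    obtain X Y where "X \<in> \<X> n" "U = F ` X" "Y \<in> \<X> (n + k)" "V = F ` Y"
      using \<open>U \<in> _\<close> \<open>V \<in> _\<close> by (elim imageE) (rule that)
    with near[OF that(1)] meet that(4) show ?thesis by simp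
  qed
  have K: "0 < 1 + K" using AL eta[of "3 * (A * L)"] by (simp add: K_def)
  have sep: "diameter (F ` X) \<le> (1 + 2 * \<eta> A) * setdist (F ` X) (F ` Y)"
    if X: "X \<in> \<X> n" and Y: "Y \<in> \<X> n" and ne: "X \<noteq> {}" "Y \<noteq> {}" and disj: "X \<inter> Y = {}" for n X Y
  proof -
    have pos: "0 < 1 + 2 * \<eta> A" using A eta[of A] by simp
    have "diameter (F ` X) / (1 + 2 * \<eta> A) \<le> setdist (F ` X) (F ` Y)"
    proof (rule le_setdistI)
      fix u v assume "u \<in> F ` X" "v \<in> F ` Y"
      then obtain x y where x: "x \<in> X" "u = F x" and y: "y \<in> Y" "v = F y" by auto
      have S: "x \<in> S" "y \<in> S" using sub X Y x y by blast+
      have "diameter (F ` X) \<le> 2 * (\<eta> A * dist (F x) (F y))"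
      proof (rule diameter_le_twice_radius[of _ "F x"])
        fix w assume "w \<in> F ` X"
        then obtain z where z: "z \<in> X" "w = F z" by auto
        have "dist x z \<le> diameter X"
          using scale_control_member(2)[OF sc X] x z by (intro diameter_bounded_bound)
        also have "\<dots> \<le> A * dist x y"
          using scale_control_separated[OF sc X Y disj] x y by simp
        finally show "dist (F x) w \<le> \<eta> A * dist (F x) (F y)"
          unfolding z(2) using S sub[OF X] z A by (intro qs) auto
      qed (use A eta[of A] in simp)
      also have "\<dots> \<le> dist u v * (1 + 2 * \<eta> A)"
        using x y by (simp add: algebra_simps)
      finally show "diameter (F ` X) / (1 + 2 * \<eta> A) \<le> dist u v"
        using pos by (simp add: pos_divide_le_eq)
    qed (use ne in auto)
    thus ?thesis using pos by (simp add: pos_divide_le_eq mult_ac)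
  qed
  have contract: "\<exists>k. \<forall>n. \<forall>X\<in>\<X> n. \<forall>Y\<in>\<X> (n + k). X \<inter> Y \<noteq> {} \<longrightarrow>
      diameter (F ` Y) \<le> 1/2 * diameter (F ` X)"
  proof -
    obtain d where d: "0 < d" "\<And>t. 0 \<le> t \<Longrightarrow> t < d \<Longrightarrow> \<eta> t < 1/4"
      using homeomorphism_half_line_small[OF hom, of "1/4"] by auto
    obtain k where "l ^ k < d / (3 * A)"
      using real_arch_pow_inv[of "d / (3 * A)" l] d A by auto
    hence k: "3 * (A * l ^ k) < d" using A by (simp add: field_simps)
    have pos: "0 < A * l ^ k" using A by simp
    have "diameter (F ` Y) \<le> 1/2 * diameter (F ` X)"
      if X: "X \<in> \<X> n" and Y: "Y \<in> \<X> (n + k)" and m: "X \<inter> Y \<noteq> {}" for n X Y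
    proof -
      have "diameter (F ` Y) \<le> 2 * \<eta> (3 * (A * l ^ k)) * diameter (F ` X)"
        using image[OF Y X _ pos scale_control_shrink[OF sc X Y m]] m by (simp add: Int_commute)
      also have "\<dots> \<le> 1/2 * diameter (F ` X)"
        using d(2)[OF _ k] pos nn[OF X] by (intro mult_right_mono) auto
      finally show ?thesis .
    qed
    thus ?thesis by blast
  qed
  show ?thesis
    unfolding quasi_visual_approximation_def
  proof (intro conjI)
    show "bounded T" by (rule bT)
    show "\<forall>n. finite ((`) F ` \<X> n) \<and> \<Union> ((`) F ` \<X> n) = T"
      using fin un FS by (metis finite_imageI image_Union)
    show "(`) F ` \<X> 0 = {T}" using X0 FS by simp
    show "\<exists>C>0. \<forall>n. \<forall>X\<in>(`) F ` \<X> n. \<forall>Y\<in>(`) F ` \<X> n. X \<inter> Y \<noteq> {} \<longrightarrow>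
        comparable C (diameter X) (diameter Y)"
      using K near'[of 0] by (intro exI[of _ "1 + K"]) (intro conjI allI ballI impI; simp)
    show "\<exists>C>0. \<forall>n. \<forall>X\<in>(`) F ` \<X> n. \<forall>Y\<in>(`) F ` \<X> (Suc n). X \<inter> Y \<noteq> {} \<longrightarrow>
        comparable C (diameter X) (diameter Y)"
      using K near'[of 1] by (intro exI[of _ "1 + K"]) (intro conjI allI ballI impI; simp)
    show "\<exists>C>0. \<forall>n. \<forall>X\<in>(`) F ` \<X> n. \<forall>Y\<in>(`) F ` \<X> n.
        X \<noteq> {} \<and> Y \<noteq> {} \<and> X \<inter> Y = {} \<longrightarrow> diameter X \<le> C * setdist X Y"
      using sep A eta[of A] by (intro exI[of _ "1 + 2 * \<eta> A"]) (auto, blast)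
    show "\<exists>k\<^sub>0::nat. \<exists>l::real. 0 < l \<and> l < 1 \<and> (\<forall>n. \<forall>X\<in>(`) F ` \<X> n. \<forall>Y\<in>(`) F ` \<X> (n + k\<^sub>0).
        X \<inter> Y \<noteq> {} \<longrightarrow> diameter Y \<le> l * diameter X)"
    proof -
      obtain k where k: "\<And>n X Y. X \<in> \<X> n \<Longrightarrow> Y \<in> \<X> (n + k) \<Longrightarrow> X \<inter> Y \<noteq> {} \<Longrightarrow>
          diameter (F ` Y) \<le> 1/2 * diameter (F ` X)"
        using contract by blast
      have "diameter V \<le> 1/2 * diameter U"
        if "U \<in> (`) F ` \<X> n" "V \<in> (`) F ` \<X> (n + k)" "U \<inter> V \<noteq> {}" for n U V
      proof -
        obtain X Y where "X \<in> \<X> n" "U = F ` X" "Y \<in> \<X> (n + k)" "V = F ` Y"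
          using \<open>U \<in> _\<close> \<open>V \<in> _\<close> by (elim imageE) (rule that)
        with k meet that(3) show ?thesis by simp
      qed
      thus ?thesis
        by (intro exI[of _ k] exI[of _ "1/2"]) auto
    qed
  qed
qed

section \<open>Distances read off from the combinatorics of the covers\<close>

text \<open>
  The definition involves incidences only, so that every injective map preserves it. The first clause
  quantifies over all sets of level \<open>n\<close> and the second provides one disjoint pair of level \<open>n + 1\<close>:
  together they say that the pair \<open>x\<close>, \<open>y\<close> is separated at level \<open>n + 1\<close> but not at level \<open>n\<close>.
\<close>

definition splitting_level :: "(nat \<Rightarrow> 'a set set) \<Rightarrow> 'a \<Rightarrow> 'a \<Rightarrow> nat \<Rightarrow> bool" where
  "splitting_level \<X> x y n \<longleftrightarrow>
     (\<forall>X\<in>\<X> n. \<forall>Y\<in>\<X> n. x \<in> X \<and> y \<in> Y \<longrightarrow> X \<inter> Y \<noteq> {}) \<and>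
     (\<exists>X\<in>\<X> (Suc n). \<exists>Y\<in>\<X> (Suc n). x \<in> X \<and> y \<in> Y \<and> X \<inter> Y = {})"

text \<open>
  Sets of level \<open>0\<close> separate nothing, while deep levels separate \<open>x\<close> and \<open>y\<close> because diameters
  tend to \<open>0\<close>.
\<close>

lemma splitting_level_exists:
  assumes sc: "scale_control S \<X> A l L" and xy: "x \<in> S" "y \<in> S" "x \<noteq> y"
  obtains n where "splitting_level \<X> x y n"
proof -
  define P where "P n \<longleftrightarrow> (\<exists>X\<in>\<X> n. \<exists>Y\<in>\<X> n. x \<in> X \<and> y \<in> Y \<and> X \<inter> Y = {})" for n
  have A: "1 \<le> A" "0 < l" "l < 1" and X0: "\<X> 0 = {S}" and bS: "bounded S"
    using sc by (auto simp: scale_control_def)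
  have dS: "0 < diameter S"
    using diameter_bounded_bound[OF bS xy(1,2)] xy(3) zero_less_dist_iff[of x y] by linarith
  obtain n where n: "l ^ n < dist x y / (2 * A * diameter S)"
    using real_arch_pow_inv[of "dist x y / (2 * A * diameter S)" l] A xy dS by auto
  obtain X where X: "X \<in> \<X> n" "x \<in> X" using scale_control_cover[OF sc xy(1)] .
  obtain Y where Y: "Y \<in> \<X> n" "y \<in> Y" using scale_control_cover[OF sc xy(2)] .
  have small: "diameter Z \<le> A * l ^ n * diameter S" if "Z \<in> \<X> n" "Z \<noteq> {}" for Z
    using scale_control_shrink[OF sc, of S 0 Z n] that X0 scale_control_member(1)[OF sc that(1)]
    by auto
  have "X \<inter> Y = {}"
  proof (rule ccontr)
    assume "X \<inter> Y \<noteq> {}"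
    then obtain p where "p \<in> X" "p \<in> Y" by auto
    hence "dist x p \<le> diameter X" "dist y p \<le> diameter Y"
      using X Y scale_control_member(2)[OF sc] by (meson diameter_bounded_bound)+
    hence "dist x y \<le> 2 * (A * l ^ n * diameter S)"
      using small[OF X(1)] small[OF Y(1)] X Y dist_triangle2[of x y p] by fastforce
    also have "\<dots> < dist x y"
      using n A dS by (simp add: field_simps)
    finally show False by simp
  qed
  hence "P n" using X Y unfolding P_def by blast
  moreover have "\<not> P 0" using X0 xy by (auto simp: P_def)
  ultimately obtain k where "\<not> P k" "P (Suc k)"
    using ex_least_nat_less[of P n] by auto
  hence "splitting_level \<X> x y k" unfolding splitting_level_def P_def by blast
  thus ?thesis by (rule that)
qed

lemma splitting_level_image:
  assumes inj: "inj_on F S" and un: "\<And>n. \<Union>(\<X> n) = S" and xy: "x \<in> S" "y \<in> S"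
    and spl: "splitting_level \<X> x y n"
  shows "splitting_level (\<lambda>n. (\<lambda>X. F ` X) ` \<X> n) (F x) (F y) n"
proof -
  have sub: "X \<subseteq> S" if "X \<in> \<X> m" for X m using un that by blast
  have mem: "F x \<in> F ` X \<longleftrightarrow> x \<in> X" "F y \<in> F ` X \<longleftrightarrow> y \<in> X" if "X \<in> \<X> m" for X m
    using inj_on_image_mem_iff[OF inj _ sub[OF that]] xy by blast+
  have meet: "F ` X \<inter> F ` Y = {} \<longleftrightarrow> X \<inter> Y = {}" if "X \<in> \<X> m" "Y \<in> \<X> m" for X Y m
    using inj_on_image_Int[OF inj sub[OF that(1)] sub[OF that(2)]] by (metis image_is_empty)
  show ?thesis
    using spl unfolding splitting_level_def by (simp add: mem meet cong: bex_cong ball_cong)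
qed

text \<open>
  A chain of two meeting sets of level \<open>n\<close> bounds the distance from above; the gap between disjoint
  sets of level \<open>n + 1\<close> bounds it from below.
\<close>

lemma splitting_level_dist:
  assumes sc: "scale_control S \<X> A l L" and xy: "x \<in> S" "y \<in> S"
    and spl: "splitting_level \<X> x y n" and X: "X \<in> \<X> n" "x \<in> X"
  shows "dist x y \<le> 2 * A * A * L * diameter X" "diameter X \<le> 2 * A * A * L * dist x y"
proof -
  have A: "1 \<le> A" "1 < L" using sc by (auto simp: scale_control_def)
  note dX = scale_control_member(3)[OF sc X(1)]
  have AL: "A \<le> A * A * L" "1 \<le> A * A * L"
  proof -
    have "1 \<le> A * L" using mult_mono[of 1 A 1 L] A by simp
    hence "A * 1 \<le> A * (A * L)" using A by (intro mult_left_mono) auto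
    thus "A \<le> A * A * L" by (simp add: mult_ac)
    with A show "1 \<le> A * A * L" by linarith
  qed
  obtain Y where Y: "Y \<in> \<X> n" "y \<in> Y" using scale_control_cover[OF sc xy(2)] .
  obtain p where p: "p \<in> X" "p \<in> Y" using spl X Y unfolding splitting_level_def by blast
  have "diameter Y \<le> A * diameter X"
    using scale_control_shrink[OF sc X(1), of Y 0] Y p by auto
  moreover have "dist x p \<le> diameter X" "dist y p \<le> diameter Y"
    using X Y p scale_control_member(2)[OF sc] by (meson diameter_bounded_bound)+
  ultimately have "dist x y \<le> diameter X + A * diameter X"
    using dist_triangle2[of x y p] by linarith
  also have "\<dots> = (1 + A) * diameter X" by (simp add: algebra_simps)
  also have "\<dots> \<le> 2 * A * A * L * diameter X"
    using AL dX by (intro mult_right_mono) auto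
  finally show "dist x y \<le> 2 * A * A * L * diameter X" .
  obtain X' Y' where X': "X' \<in> \<X> (Suc n)" "x \<in> X'" and Y': "Y' \<in> \<X> (Suc n)" "y \<in> Y'"
    and disj: "X' \<inter> Y' = {}"
    using spl unfolding splitting_level_def by blast
  have "diameter X \<le> A * L * diameter X'"
    using scale_control_grow[OF sc X(1), of X' 1] X X' by auto
  also have "\<dots> \<le> A * L * (A * dist x y)"
    using scale_control_separated[OF sc X'(1) Y'(1) disj X'(2) Y'(2)] A by (intro mult_left_mono) auto
  also have "\<dots> \<le> 2 * A * A * L * dist x y"
    using A by (simp add: mult_ac)
  finally show "diameter X \<le> 2 * A * A * L * dist x y" .
qed

section \<open>Maps preserving quasi-visual approximations are quasisymmetries\<close>

text \<open>
  The exponent \<open>a\<close> is chosen so that \<open>l = L powr (- a)\<close>; a bound on the growth \<open>L ^ k\<close> can then be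
  read as a bound on the decay \<open>l ^ k\<close>, and conversely, without mentioning \<open>k\<close>.
\<close>

lemma geometric_rate_exchange:
  fixes l L c a :: real
  assumes l: "0 < l" "l < 1" and L: "1 < L" and c: "0 < c" and a: "a = - ln l / ln L"
  shows "1 \<le> c * L ^ k \<Longrightarrow> l ^ k \<le> c powr a"
    and "1 \<le> c * l ^ k \<Longrightarrow> L ^ k \<le> c powr (1 / a)"
proof -
  have lnL: "0 < ln L" and lnl: "ln l < 0" using l L by auto
  have a0: "0 < a" using lnL lnl by (simp add: a divide_neg_pos)
  have la: "l = L powr (- a)"
    using l L lnL by (simp add: a powr_def)
  have lk: "l ^ k = (L ^ k) powr (- a)"
    using L by (simp add: la powr_power powr_realpow[symmetric] powr_powr mult_ac)
  show "l ^ k \<le> c powr a" if "1 \<le> c * L ^ k"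
  proof -
    have "1 \<le> (c * L ^ k) powr a" using that a0 by (simp add: ge_one_powr_ge_zero)
    also have "\<dots> = c powr a * (L ^ k) powr a" using c L by (simp add: powr_mult)
    finally show ?thesis using L by (simp add: lk powr_minus field_simps)
  qed
  show "L ^ k \<le> c powr (1 / a)" if "1 \<le> c * l ^ k"
  proof -
    have "(L ^ k) powr a \<le> c" using that L by (simp add: lk powr_minus field_simps)
    hence "((L ^ k) powr a) powr (1 / a) \<le> c powr (1 / a)" using a0 by (intro powr_mono2) auto
    thus ?thesis using a0 L by (simp add: powr_powr)
  qed
qed

text \<open>
  Let \<open>X\<close> and \<open>Z\<close> contain \<open>x\<close> at the splitting levels \<open>n\<close> of \<open>x\<close>, \<open>y\<close> and \<open>m\<close> of \<open>x\<close>, \<open>z\<close>. If \<open>m \<le> n\<close>,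
  then \<open>X\<close> can be small relative to \<open>Z\<close> only when \<open>n - m\<close> is large, and this forces \<open>F ` X\<close> to be small
  relative to \<open>F ` Z\<close>; this gives the exponent \<open>a\<close>. If \<open>n < m\<close>, then \<open>t\<close> bounds \<open>m - n\<close>, and with it
  the growth from \<open>F ` Z\<close> to \<open>F ` X\<close>; this gives the exponent \<open>1 / a\<close>.
\<close>

lemma scale_control_power_quasisymmetric:
  fixes F :: "'a::metric_space \<Rightarrow> 'b::metric_space"
  assumes scS: "scale_control S \<X> A l L" and scT: "scale_control T (\<lambda>n. (\<lambda>X. F ` X) ` \<X> n) A l L"
    and inj: "inj_on F S"
    and a: "a = - ln l / ln L" and D: "D = 2 * A * A * L"
    and t: "0 < t" and xyz: "x \<in> S" "y \<in> S" "z \<in> S" and le: "dist x y \<le> t * dist x z"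
  shows "dist (F x) (F y) \<le>
    D * D * A * ((A * D * D * t) powr a + (A * D * D * t) powr (1 / a)) * dist (F x) (F z)"
proof (cases "x = y \<or> x = z")
  case True
  with le have "x = y" by auto
  moreover have "0 \<le> A" "0 \<le> D" using scS D by (auto simp: scale_control_def)
  ultimately show ?thesis by (auto intro!: mult_nonneg_nonneg add_nonneg_nonneg)
next
  case False
  have A: "1 \<le> A" "0 < l" "l < 1" "1 < L" and un: "\<And>n. \<Union>(\<X> n) = S" and X0: "\<X> 0 = {S}"
    using scS by (auto simp: scale_control_def)
  have D0: "0 < D" using A by (simp add: D)
  have FS: "F w \<in> T" if "w \<in> S" for w
    using scT X0 that by (auto simp: scale_control_def)
  define c where "c = A * D * D * t"
  have c: "0 < c" using A D0 t by (simp add: c_def)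
  obtain n where n: "splitting_level \<X> x y n"
    using splitting_level_exists[OF scS xyz(1,2)] False by blast
  obtain m where m: "splitting_level \<X> x z m"
    using splitting_level_exists[OF scS xyz(1,3)] False by blast
  obtain X where X: "X \<in> \<X> n" "x \<in> X" using scale_control_cover[OF scS xyz(1)] .
  obtain Z where Z: "Z \<in> \<X> m" "x \<in> Z" using scale_control_cover[OF scS xyz(1)] .
  have FX: "F ` X \<in> (\<lambda>X. F ` X) ` \<X> n" "F x \<in> F ` X"
    and FZ: "F ` Z \<in> (\<lambda>X. F ` X) ` \<X> m" "F x \<in> F ` Z"
    using X Z by auto
  note spy = splitting_level_dist[OF scS xyz(1,2) n X, folded D]
  note spz = splitting_level_dist[OF scS xyz(1,3) m Z, folded D]
  note ny = splitting_level_image[OF inj un xyz(1,2) n]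
  note mz = splitting_level_image[OF inj un xyz(1,3) m]
  note Fy = splitting_level_dist[OF scT FS[OF xyz(1)] FS[OF xyz(2)] ny FX, folded D]
  note Fz = splitting_level_dist[OF scT FS[OF xyz(1)] FS[OF xyz(3)] mz FZ, folded D]
  have dZ: "0 < diameter Z"
  proof -
    have "0 < dist x z" using False by simp
    also have "\<dots> \<le> D * diameter Z" by (rule spz)
    finally show ?thesis using D0 by (simp add: zero_less_mult_iff)
  qed
  have dFZ: "0 \<le> diameter (F ` Z)"
    using scale_control_member(3)[OF scT FZ(1)] .
  have XZ: "diameter X \<le> D * D * t * diameter Z"
  proof -
    have "diameter X \<le> D * dist x y" by (rule spy)
    also have "\<dots> \<le> D * (t * (D * diameter Z))"
      using D0 le spz t by (meson mult_left_mono order_trans less_imp_le)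
    finally show ?thesis by (simp add: mult_ac)
  qed
  have "diameter (F ` X) \<le> A * (c powr a + c powr (1 / a)) * diameter (F ` Z)"
  proof (cases "m \<le> n")
    case True
    then obtain k where k: "n = m + k" using le_Suc_ex by blast
    have "diameter Z \<le> A * L ^ k * diameter X"
      using scale_control_grow[OF scS Z(1), of X k] X Z k by auto
    also have "\<dots> \<le> A * L ^ k * (D * D * t * diameter Z)"
      using XZ A by (intro mult_left_mono) auto
    finally have "1 * diameter Z \<le> (c * L ^ k) * diameter Z" by (simp add: c_def mult_ac)
    hence "1 \<le> c * L ^ k" using dZ by (simp only: mult_le_cancel_right_pos)
    hence "l ^ k \<le> c powr a" by (rule geometric_rate_exchange(1)[OF A(2-4) c a])
    hence "l ^ k \<le> c powr a + c powr (1 / a)" by (simp add: add_increasing2)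
    hence "A * l ^ k * diameter (F ` Z) \<le> A * (c powr a + c powr (1 / a)) * diameter (F ` Z)"
      using A dFZ by (intro mult_right_mono mult_left_mono) auto
    moreover have "diameter (F ` X) \<le> A * l ^ k * diameter (F ` Z)"
      using scale_control_shrink[OF scT FZ(1), of "F ` X" k] FX FZ k by auto
    ultimately show ?thesis by linarith
  next
    case False
    then obtain k where k: "m = n + k" using le_Suc_ex nat_le_linear by metis
    have "diameter Z \<le> A * l ^ k * diameter X"
      using scale_control_shrink[OF scS X(1), of Z k] X Z k by auto
    also have "\<dots> \<le> A * l ^ k * (D * D * t * diameter Z)"
      using XZ A by (intro mult_left_mono) auto
    finally have "1 * diameter Z \<le> (c * l ^ k) * diameter Z" by (simp add: c_def mult_ac)
    hence "1 \<le> c * l ^ k" using dZ by (simp only: mult_le_cancel_right_pos)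
    hence "L ^ k \<le> c powr (1 / a)" by (rule geometric_rate_exchange(2)[OF A(2-4) c a])
    hence "L ^ k \<le> c powr a + c powr (1 / a)" by (simp add: add_increasing)
    hence "A * L ^ k * diameter (F ` Z) \<le> A * (c powr a + c powr (1 / a)) * diameter (F ` Z)"
      using A dFZ by (intro mult_right_mono mult_left_mono) auto
    moreover have "diameter (F ` X) \<le> A * L ^ k * diameter (F ` Z)"
      using scale_control_grow[OF scT FX(1), of "F ` Z" k] FX FZ k by auto
    ultimately show ?thesis by linarith
  qed
  hence "D * diameter (F ` X) \<le> D * (A * (c powr a + c powr (1 / a)) * (D * dist (F x) (F z)))"
    using Fz(2) A D0
    by (smt (verit) mult_left_mono mult_nonneg_nonneg powr_ge_zero)
  with Fy(1) show ?thesis by (simp add: c_def mult_ac)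
qed

lemma quasisymmetric_inequality_continuous:
  fixes F :: "'a::metric_space \<Rightarrow> 'b::metric_space"
  assumes hom: "homeomorphism {0..} {0..} \<eta> \<theta>"
    and qs: "\<And>t x y z. 0 < t \<Longrightarrow> x \<in> S \<Longrightarrow> y \<in> S \<Longrightarrow> z \<in> S \<Longrightarrow> dist x y \<le> t * dist x z \<Longrightarrow>
                 dist (F x) (F y) \<le> \<eta> t * dist (F x) (F z)"
  shows "continuous_on S F"
  unfolding continuous_on_iff
proof (intro ballI allI impI)
  fix x and e :: real assume x: "x \<in> S" and e: "0 < e"
  show "\<exists>d>0. \<forall>y\<in>S. dist y x < d \<longrightarrow> dist (F y) (F x) < e"
  proof (cases "\<exists>z\<in>S. z \<noteq> x")
    case False
    thus ?thesis using e by (intro exI[of _ 1]) auto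
  next
    case True
    then obtain z where z: "z \<in> S" "z \<noteq> x" by blast
    \<comment> \<open>The summand \<open>1\<close> keeps \<open>r\<close> positive even if \<open>F x = F z\<close>.\<close>
    define r where "r = 1 + dist (F x) (F z)"
    have r: "0 < r" "dist (F x) (F z) \<le> r" by (auto simp: r_def add_pos_nonneg)
    obtain d where d: "0 < d" "\<And>t. 0 \<le> t \<Longrightarrow> t < d \<Longrightarrow> \<eta> t < e / r"
      using homeomorphism_half_line_small[OF hom, of "e / r"] e r by auto
    have "dist (F y) (F x) < e" if y: "y \<in> S" "dist y x < d * dist x z" for y
    proof (cases "y = x")
      case True thus ?thesis using e by simp
    next
      case False
      define t where "t = dist x y / dist x z"
      have t: "0 < t" "t < d" "dist x y \<le> t * dist x z"
        using False z y by (auto simp: t_def field_simps dist_commute)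
      have "dist (F x) (F y) \<le> \<eta> t * dist (F x) (F z)"
        using t x y z by (intro qs) auto
      also have "\<dots> \<le> \<eta> t * r"
      proof (rule mult_left_mono[OF r(2)])
        show "0 \<le> \<eta> t"
          using hom t(1) unfolding homeomorphism_def by (metis atLeast_iff imageI less_imp_le)
      qed
      also have "\<dots> < e" using d(2)[of t] t r by (simp add: field_simps)
      finally show ?thesis by (simp add: dist_commute)
    qed
    thus ?thesis using d z by (intro exI[of _ "d * dist x z"]) auto
  qed
qed

text \<open>
  Only the inequality is obtained here; continuity is postponed, since for the inverse of \<open>F\<close> it comes
  from applying this lemma to the inverse map.
\<close>

lemma quasi_visual_image_imp_quasisymmetric_inequality:
  fixes F :: "'a::metric_space \<Rightarrow> 'b::metric_space"
  assumes inj: "inj_on F S" and qvS: "quasi_visual_approximation S \<X>"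
    and qvT: "quasi_visual_approximation T (\<lambda>n. (\<lambda>X. F ` X) ` \<X> n)"
  obtains \<eta> \<theta> where "homeomorphism {0::real..} {0::real..} \<eta> \<theta>"
    "\<And>t x y z. 0 < t \<Longrightarrow> x \<in> S \<Longrightarrow> y \<in> S \<Longrightarrow> z \<in> S \<Longrightarrow> dist x y \<le> t * dist x z \<Longrightarrow>
                 dist (F x) (F y) \<le> \<eta> t * dist (F x) (F z)"
proof -
  obtain A1 l1 L1 where 1: "scale_control S \<X> A1 l1 L1"
    using quasi_visual_approximation_scale_control[OF qvS] .
  obtain A2 l2 L2 where 2: "scale_control T (\<lambda>n. (\<lambda>X. F ` X) ` \<X> n) A2 l2 L2"
    using quasi_visual_approximation_scale_control[OF qvT] .
  define A where "A = max A1 A2"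
  define l where "l = max l1 l2"
  define L where "L = max L1 L2"
  have bounds: "A1 \<le> A" "A2 \<le> A" "l1 \<le> l" "l2 \<le> l" "l < 1" "L1 \<le> L" "L2 \<le> L"
    using 1 2 by (auto simp: A_def l_def L_def scale_control_def)
  have scS: "scale_control S \<X> A l L"
    and scT: "scale_control T (\<lambda>n. (\<lambda>X. F ` X) ` \<X> n) A l L"
    using scale_control_mono[OF 1] scale_control_mono[OF 2] bounds by auto
  have A: "1 \<le> A" "0 < l" "l < 1" "1 < L" using scS by (auto simp: scale_control_def)
  define a where "a = - ln l / ln L"
  define D where "D = 2 * A * A * L"
  have a: "0 < a" using A by (simp add: a_def divide_neg_pos)
  have D: "0 < D" using A by (simp add: D_def)
  obtain \<theta> where "homeomorphism {0..} {0..}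
      (\<lambda>t. (D * D * A) * (((A * D * D) * t) powr a + ((A * D * D) * t) powr (1 / a))) \<theta>"
    using homeomorphism_power_gauge[of a "1 / a" "A * D * D" "D * D * A"] a A D by auto
  thus ?thesis
    by (rule that) (rule scale_control_power_quasisymmetric[OF scS scT inj a_def D_def])
qed

lemma quasi_visual_image_imp_quasisymmetry:
  fixes F :: "'a::metric_space \<Rightarrow> 'b::metric_space"
  assumes bij: "bij_betw F S T" and qvS: "quasi_visual_approximation S \<X>"
    and qvT: "quasi_visual_approximation T (\<lambda>n. (\<lambda>X. F ` X) ` \<X> n)"
  shows "quasisymmetry S T F"
proof -
  define G where "G = inv_into S F"
  have inj: "inj_on F S" and FS: "F ` S = T" using bij by (auto simp: bij_betw_def)
  have bijG: "bij_betw G T S" unfolding G_def by (rule bij_betw_inv_into[OF bij])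
  have GF: "G (F x) = x" if "x \<in> S" for x
    using inj that by (simp add: G_def)
  have FG: "F (G y) = y" if "y \<in> T" for y
    using FS that by (simp add: G_def f_inv_into_f)
  have "(\<lambda>n. (\<lambda>Y. G ` Y) ` (\<lambda>X. F ` X) ` \<X> n) = \<X>"
  proof
    fix n
    have un: "\<Union>(\<X> n) = S"
      using qvS by (simp add: quasi_visual_approximation_def)
    have "G ` F ` X = X" if "X \<in> \<X> n" for X
      unfolding G_def using that un by (intro inv_into_image_cancel[OF inj]) blast
    thus "(\<lambda>Y. G ` Y) ` (\<lambda>X. F ` X) ` \<X> n = \<X> n"
      by (simp add: image_image)
  qed
  hence qvG: "quasi_visual_approximation S (\<lambda>n. (\<lambda>Y. G ` Y) ` (\<lambda>X. F ` X) ` \<X> n)"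
    using qvS by simp
  obtain \<eta> \<theta> where eta: "homeomorphism {0::real..} {0::real..} \<eta> \<theta>"
    "\<And>t x y z. 0 < t \<Longrightarrow> x \<in> S \<Longrightarrow> y \<in> S \<Longrightarrow> z \<in> S \<Longrightarrow> dist x y \<le> t * dist x z \<Longrightarrow>
                 dist (F x) (F y) \<le> \<eta> t * dist (F x) (F z)"
    by (rule quasi_visual_image_imp_quasisymmetric_inequality[OF inj qvS qvT]) (rule that)
  obtain \<eta>' \<theta>' where eta': "homeomorphism {0::real..} {0::real..} \<eta>' \<theta>'"
    "\<And>t x y z. 0 < t \<Longrightarrow> x \<in> T \<Longrightarrow> y \<in> T \<Longrightarrow> z \<in> T \<Longrightarrow> dist x y \<le> t * dist x z \<Longrightarrow>
                 dist (G x) (G y) \<le> \<eta>' t * dist (G x) (G z)"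
    by (rule quasi_visual_image_imp_quasisymmetric_inequality[OF bij_betw_imp_inj_on[OF bijG] qvT qvG])
      (rule that)
  have "continuous_on S F" by (rule quasisymmetric_inequality_continuous[OF eta])
  moreover have "continuous_on T G" by (rule quasisymmetric_inequality_continuous[OF eta'])
  ultimately have "homeomorphism S T F G"
    using FS bijG GF FG by (auto simp: homeomorphism_def bij_betw_def)
  thus ?thesis
    unfolding quasisymmetry_def
    by (intro conjI exI[of _ G] exI[of _ \<eta>] exI[of _ \<theta>] eta(1) allI impI ballI eta(2))
qed

theorem proposition2p7:
  fixes S :: "'a::metric_space set" and T :: "'b::metric_space set"
    and F :: "'a \<Rightarrow> 'b" and \<X> :: "nat \<Rightarrow> 'a set set"
  assumes "bounded S" and "bounded T"
    and "bij_betw F S T"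
    and "quasi_visual_approximation S \<X>"
  shows "quasisymmetry S T F \<longleftrightarrow>
    quasi_visual_approximation T (\<lambda>n. (\<lambda>X. F ` X) ` \<X> n)"
  using quasisymmetry_imp_quasi_visual_image[OF assms(2-4)]
    quasi_visual_image_imp_quasisymmetry[OF assms(3,4)] by blast

end
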